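(* For any $p\in\,]0,1[$ there exist a set $E_p\subset I^\infty$ of measure $p$ and a constant $C_p$ such that for any $f\in E_p$ and any $d\ge1$, $$\mathcal{Z}_d(f)\le C_pd^8,$$ where $\mathcal{Z}_d(f)$ counts zeroes in $D_{1/4}$ and $C_p\to+\infty$ as $p\to1$. In other words, with probability $1$, random series $f\in I^\infty$ satisfy polynomial Bézout bounds of degree at most $8$: for $\mu$-almost every $f\in I^\infty$ there is a constant $C$ such that $\mathcal{Z}_d(f)\le Cd^8$ for all $d\ge1$.
   Context: $D_r=\{z\in\mathbb{C}:|z|\le r\}$. $I=[-1,1]\subset\mathbb{R}$; $I^\infty$ is the set of sequences $(a_k)_{k\ge0}$ with $a_k\in I$, equipped with the product probability measure $\mu$ of the normalized Lebesgue (probability) measures on the factors $I$. A sequence $(a_k)_{k\ge0}\in I^\infty$ is identified with the analytic function $f(z)=\sum_{k\ge0}a_kz^k$, convergent at least for $|z|<1$. $\mathcal{Z}_d(f)$ is the maximum, over all $(p_0,\dots,p_d)\ne(0,\dots,0)$ with $p_j\in\mathbb{C}[z]$, $\deg p_j\le d$, of the number of zeroes (with multiplicity) in $D_{1/4}$ of $\sum_{j=0}^dp_j(z)f(z)^j$. *)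

theory Defs
  imports "HOL-Probability.Probability" "HOL-Complex_Analysis.Complex_Analysis"
begin

definition unif_I :: "real measure" where
  "unif_I = restrict_space (uniform_measure lborel {-1..1}) {-1..1}"

definition coeff_measure :: "(nat \<Rightarrow> real) measure" where
  "coeff_measure = PiM UNIV (\<lambda>_. unif_I)"

lemma prob_space_unif_I: "prob_space unif_I"
  unfolding unif_I_def
  by (rule prob_space_restrict_space) auto

lemma space_coeff_measure: "space coeff_measure = {a. \<forall>k. a k \<in> {-1..1}}"
  by (auto simp: coeff_measure_def unif_I_def space_PiM space_restrict_space PiE_def Pi_def)

lemma prob_space_coeff_measure: "prob_space coeff_measure"
  unfolding coeff_measure_def by (rule prob_space_PiM) (rule prob_space_unif_I)

text \<open>Only the values on the open unit disc, where the series converges for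
  coefficients in \<open>[-1, 1]\<close>, are ever relevant.\<close>

definition series_fun :: "(nat \<Rightarrow> real) \<Rightarrow> complex \<Rightarrow> complex" where
  "series_fun a z = (\<Sum>k. of_real (a k) * z ^ k)"

text \<open>Number of zeroes with multiplicity, intended for \<open>g\<close> analytic on a connected neighbourhood
  of \<open>S\<close>. If \<open>S\<close> is a closed disc, infinitely many zeroes occur exactly when \<open>g\<close> vanishes
  identically; the count is then infinite, and otherwise every zero has a finite order, which is
  \<^term>\<open>zorder g z\<close>.\<close>

definition zero_count :: "(complex \<Rightarrow> complex) \<Rightarrow> complex set \<Rightarrow> enat" where
  "zero_count g S =
     (if finite {z \<in> S. g z = 0} then enat (\<Sum>z \<in> {z \<in> S. g z = 0}. nat (zorder g z)) else \<infinity>)"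

text \<open>The maximum is taken as a supremum in the extended naturals: it is attained whenever it is
  finite, and it is \<open>\<infinity>\<close> if zero counts are unbounded or if some nontrivial combination vanishes
  identically.\<close>

definition bezout_number :: "nat \<Rightarrow> (complex \<Rightarrow> complex) \<Rightarrow> enat" where
  "bezout_number d f =
     (SUP p \<in> {p :: nat \<Rightarrow> complex poly. (\<forall>j\<le>d. degree (p j) \<le> d) \<and> (\<exists>j\<le>d. p j \<noteq> 0)}.
        zero_count (\<lambda>z. \<Sum>j\<le>d. poly (p j) z * f z ^ j) (cball 0 (1/4)))"

end

theory Submission
  imports Defs "Jordan_Normal_Form.Determinant" "HOL-Computational_Algebra.Fundamental_Theorem_Algebra"
    "HOL-Real_Asymp.Real_Asymp"
begin

text \<open>
  Let \<open>N = (d + 1)\<^sup>2\<close> and let \<open>A(a)\<close> be the \<open>N \<times> N\<close> matrix of the first \<open>N\<close> Taylor coefficients of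
  the functions \<open>z ^ i * f ^ j\<close> with \<open>i, j \<le> d\<close>. Its entries in a column with exponent \<open>j\<close> have
  degree at most \<open>j\<close> in the single variable \<open>x = a (d + 1)\<close>, and the coefficients of \<open>x ^ j\<close> are the
  Taylor coefficients of \<open>z ^ (i + (d + 1) * j)\<close>, so they form the identity matrix. Hence
  \<open>det A(a)\<close> is a monic polynomial in \<open>x\<close>, of degree \<open>D = O(d ^ 3)\<close>, whatever the other coefficients
  are: if \<open>|det A(a)| \<le> s ^ D\<close>, then \<open>x\<close> is within \<open>s\<close> of one of its \<open>D\<close> roots, which has
  probability at most \<open>s * D\<close>. With \<open>s\<close> of order \<open>2 ^ -d / D\<close> these probabilities are summable.

  A lower bound for the determinant gives, through the adjugate matrix, a lower bound for one of the
  first \<open>N\<close> Taylor coefficients of any combination \<open>\<Sum> p_j f ^ j\<close>, relative to the largest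
  coefficient of the \<open>p_j\<close>. A function with many zeroes in \<open>cball 0 (1/4)\<close> that is bounded on a
  larger disc has small Taylor coefficients, and comparing both bounds limits the number of zeroes by
  \<open>O(d ^ 6)\<close>.
\<close>

section \<open>The determinant of Taylor coefficients\<close>

text \<open>In the convolution only the split of \<open>m + n\<close> into \<open>m\<close> and
  \<open>n\<close> keeps both indices within the degree bounds. The bounds need not be the exact
  degrees, so the formula also covers entries whose top coefficient vanishes.\<close>

lemma coeff_mult_degree_le:
  fixes p q :: "'a :: comm_semiring_0 poly"
  assumes "degree p \<le> m" "degree q \<le> n"
  shows "coeff (p * q) (m + n) = coeff p m * coeff q n"
proof -
  have "coeff (p * q) (m + n) = (\<Sum>i\<le>m + n. coeff p i * coeff q (m + n - i))"
    by (simp add: coeff_mult)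
  also have "\<dots> = (\<Sum>i\<in>{m}. coeff p i * coeff q (m + n - i))"
  proof (rule sum.mono_neutral_right)
    show "\<forall>i\<in>{..m + n} - {m}. coeff p i * coeff q (m + n - i) = 0"
    proof
      fix i assume i: "i \<in> {..m + n} - {m}"
      show "coeff p i * coeff q (m + n - i) = 0"
      proof (cases "i < m")
        case True
        then have "coeff q (m + n - i) = 0" using assms by (intro coeff_eq_0) linarith
        then show ?thesis by simp
      next
        case False
        then have "coeff p i = 0" using assms i by (intro coeff_eq_0) auto
        then show ?thesis by simp
      qed
    qed
  qed auto
  finally show ?thesis by simp
qed

text \<open>Formal top coefficients are multiplicative when each factor has its own degree bound;
  this is used for the products in the Leibniz formula.\<close>

lemma degree_coeff_prod_le:
  fixes p :: "'b \<Rightarrow> 'a :: comm_semiring_1 poly"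
  assumes "finite A" "\<And>i. i \<in> A \<Longrightarrow> degree (p i) \<le> e i"
  shows "degree (\<Prod>i\<in>A. p i) \<le> (\<Sum>i\<in>A. e i)
     \<and> coeff (\<Prod>i\<in>A. p i) (\<Sum>i\<in>A. e i) = (\<Prod>i\<in>A. coeff (p i) (e i))"
  using assms
proof (induction A rule: finite_induct)
  case empty
  then show ?case by simp
next
  case (insert x A)
  then have IH: "degree (\<Prod>i\<in>A. p i) \<le> (\<Sum>i\<in>A. e i)"
     "coeff (\<Prod>i\<in>A. p i) (\<Sum>i\<in>A. e i) = (\<Prod>i\<in>A. coeff (p i) (e i))" and x: "degree (p x) \<le> e x"
    by auto
  have "degree (p x * (\<Prod>i\<in>A. p i)) \<le> e x + (\<Sum>i\<in>A. e i)"
    using degree_mult_le[of "p x" "\<Prod>i\<in>A. p i"] IH(1) x by linarith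
  with insert.hyps coeff_mult_degree_le[OF x IH(1)] IH(2) show ?case by simp
qed

definition coeff_fps :: "(nat \<Rightarrow> real) \<Rightarrow> complex fps" where
  "coeff_fps a = Abs_fps (\<lambda>k. of_real (a k))"

text \<open>Coefficient number \<open>k\<close> becomes the indeterminate while all others are
  frozen, so a determinant over this series is a polynomial in that single coefficient.\<close>

definition indet_fps :: "nat \<Rightarrow> (nat \<Rightarrow> real) \<Rightarrow> complex poly fps" where
  "indet_fps k a = Abs_fps (\<lambda>i. if i = k then [:0, 1:] else [:of_real (a i):])"

lemma poly_indet_fps_power:
  "poly (fps_nth (indet_fps k a ^ j) m) (of_real x) = fps_nth (coeff_fps (a(k := x)) ^ j) m"
proof (induction j arbitrary: m)
  case 0
  then show ?case by (simp add: fps_one_nth)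
next
  case (Suc j)
  show ?case
    by (simp add: fps_mult_nth poly_sum Suc)
      (rule sum.cong, auto simp: indet_fps_def coeff_fps_def)
qed

text \<open>A product of \<open>j\<close> coefficients reaches degree \<open>j\<close> in the
  indeterminate only if every factor is coefficient number \<open>k\<close>, and such a product
  belongs to the exponent \<open>k * j\<close> of the series variable.\<close>

lemma degree_coeff_indet_fps_power:
  "degree (fps_nth (indet_fps k a ^ j) m) \<le> j \<and>
   coeff (fps_nth (indet_fps k a ^ j) m) j = (if m = k * j then 1 else 0)"
proof (induction j arbitrary: m)
  case 0
  then show ?case by (simp add: fps_one_nth)
next
  case (Suc j)
  have d1: "degree (fps_nth (indet_fps k a) i) \<le> 1" for i
    by (simp add: indet_fps_def)
  have c1: "coeff (fps_nth (indet_fps k a) i) 1 = (if i = k then 1 else 0)" for i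
    by (simp add: indet_fps_def)
  have deg: "degree (fps_nth (indet_fps k a) i * fps_nth (indet_fps k a ^ j) (m - i)) \<le> Suc j" for i
    using degree_mult_le[of "fps_nth (indet_fps k a) i" "fps_nth (indet_fps k a ^ j) (m - i)"]
      d1[of i] Suc[of "m - i"] by linarith
  have co: "coeff (fps_nth (indet_fps k a) i * fps_nth (indet_fps k a ^ j) (m - i)) (Suc j) =
      (if i = k then if m - i = k * j then 1 else 0 else 0)" for i
    using coeff_mult_degree_le[OF d1[of i], of "fps_nth (indet_fps k a ^ j) (m - i)" j]
      Suc[of "m - i"] c1[of i] by simp
  have "coeff (fps_nth (indet_fps k a ^ Suc j) m) (Suc j) =
      (\<Sum>i=0..m. if i = k then if m - i = k * j then 1 else 0 else 0)"
    by (simp add: fps_mult_nth coeff_sum co)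
  \<comment> \<open>The truncated difference does no harm: the sum reaches \<open>i = k\<close> only
    if \<open>k \<le> m\<close>, and then \<open>m - k = k * j\<close> means
    \<open>m = k * Suc j\<close>.\<close>
  also have "\<dots> = (if m = k * Suc j then 1 else 0)"
    by (auto simp: sum.delta)
  finally show ?case
    using deg by (auto simp: fps_mult_nth intro!: degree_sum_le)
qed

text \<open>Column \<open>n\<close> stands for the monomial \<open>z ^ (n mod (d + 1)) * f ^ (n div (d + 1))\<close>;
  the rows are Taylor coefficients.\<close>

definition taylor_mat :: "nat \<Rightarrow> 'a :: comm_ring_1 fps \<Rightarrow> 'a mat" where
  "taylor_mat d F = Matrix.mat ((d + 1)\<^sup>2) ((d + 1)\<^sup>2) (\<lambda>(m, n).
     if m < n mod (d + 1) then 0 else fps_nth (F ^ (n div (d + 1))) (m - n mod (d + 1)))"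

text \<open>The sum over all columns of the exponent of \<open>f\<close>; its value is half of
  \<open>d * (d + 1)^2\<close>.\<close>

definition det_degree :: "nat \<Rightarrow> nat" where
  "det_degree d = (\<Sum>n<(d + 1)\<^sup>2. n div (d + 1))"

lemma taylor_mat_carrier: "taylor_mat d F \<in> carrier_mat ((d + 1)\<^sup>2) ((d + 1)\<^sup>2)"
  by (simp add: taylor_mat_def)

text \<open>The expansion runs over columns because the degree bound of an entry depends only on its
  column; every term then has the same total bound \<open>det_degree d\<close>.\<close>

lemma det_taylor_mat:
  "Determinant.det (taylor_mat d F) = (\<Sum>p | p permutes {0..<(d + 1)\<^sup>2}. signof p *
     (\<Prod>n = 0..<(d + 1)\<^sup>2. taylor_mat d F $$ (p n, n)))"
  by (rule det_col[OF taylor_mat_carrier, unfolded atLeast0LessThan[symmetric]])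

text \<open>Column \<open>d + 1\<close> alone contributes 1. Positivity matters because the
  thresholds for small determinants divide by \<open>det_degree d\<close>.\<close>

lemma det_degree_pos: "d \<ge> 1 \<Longrightarrow> det_degree d > 0"
proof -
  assume d: "d \<ge> 1"
  have "d + 1 < (d + 1)\<^sup>2" using d by (simp add: power2_eq_square)
  then have "(d + 1) div (d + 1) \<le> det_degree d"
    unfolding det_degree_def by (intro member_le_sum) auto
  then show ?thesis by simp
qed

lemma det_degree_le: "det_degree d \<le> (d + 1)\<^sup>2 * d"
proof -
  have "n div (d + 1) \<le> d" if "n < (d + 1)\<^sup>2" for n
    using less_mult_imp_div_less[of n "d + 1" "d + 1"] that by (simp add: power2_eq_square)
  then have "det_degree d \<le> (\<Sum>n<(d + 1)\<^sup>2. d)"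
    unfolding det_degree_def by (intro sum_mono) auto
  then show ?thesis by simp
qed

text \<open>The top coefficients of the entries form the identity matrix, so among all permutations
  only the identity contributes in degree \<open>det_degree d\<close>, and it contributes 1.\<close>

lemma monic_det_indet:
  defines "q \<equiv> \<lambda>d a. Determinant.det (taylor_mat d (indet_fps (d + 1) a))"
  shows "degree (q d a) = det_degree d \<and> lead_coeff (q d a) = 1"
proof -
  define N where "N = (d + 1)\<^sup>2"
  define A where "A = taylor_mat d (indet_fps (d + 1) a)"
  have ent: "degree (A $$ (m, n)) \<le> n div (d + 1) \<and>
    coeff (A $$ (m, n)) (n div (d + 1)) = (if m = n then 1 else 0)" if "m < N" "n < N" for m n
  proof (cases "m < n mod (d + 1)")
    case True
    then have "m \<noteq> n" by (metis mod_less_eq_dividend not_less)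
    with True that show ?thesis by (simp add: A_def taylor_mat_def N_def)
  next
    case False
    \<comment> \<open>This is where the choice of coefficient \<open>d + 1\<close> enters: the
      exponents \<open>i + (d + 1) * j\<close> enumerate the column indices exactly once.\<close>
    have "m - n mod (d + 1) = (d + 1) * (n div (d + 1)) \<longleftrightarrow> m = n"
      using False mult_div_mod_eq[of "d + 1" n] by linarith
    with False that show ?thesis
      using degree_coeff_indet_fps_power[of "d + 1" a "n div (d + 1)" "m - n mod (d + 1)"]
      by (simp add: A_def taylor_mat_def N_def)
  qed
  have D: "det_degree d = (\<Sum>n = 0..<N. n div (d + 1))"
    by (simp add: det_degree_def N_def atLeast0LessThan)
  define t where "t p = (\<Prod>n = 0..<N. A $$ (p n, n))" for p :: "nat \<Rightarrow> nat"
  have t: "degree (t p) \<le> det_degree d \<and>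
      coeff (t p) (det_degree d) = (if p = id then 1 else 0)" if p: "p permutes {0..<N}" for p
  proof -
    have pN: "p n < N" if "n < N" for n
      using permutes_in_image[OF p, of n] that by simp
    have "degree (t p) \<le> det_degree d \<and>
      coeff (t p) (det_degree d) = (\<Prod>n = 0..<N. coeff (A $$ (p n, n)) (n div (d + 1)))"
      unfolding t_def D using ent pN by (intro degree_coeff_prod_le) auto
    moreover have "(\<Prod>n = 0..<N. coeff (A $$ (p n, n)) (n div (d + 1))) =
        (\<Prod>n = 0..<N. if p n = n then 1 else 0)"
      using ent pN by (intro prod.cong) auto
    moreover have "\<dots> = (if p = id then 1 else 0)"
    proof (cases "p = id")
      case False
      then obtain n where "p n \<noteq> n" by (auto simp: fun_eq_iff)
      moreover from this have "n \<in> {0..<N}" using p by (meson permutes_not_in)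
      ultimately show ?thesis using False by (auto intro!: prod_zero)
    qed auto
    ultimately show ?thesis by simp
  qed
  have q: "q d a = (\<Sum>p | p permutes {0..<N}. signof p * t p)"
    unfolding q_def det_taylor_mat t_def N_def A_def ..
  have deg: "degree (q d a) \<le> det_degree d"
    unfolding q using t by (intro degree_sum_le) (auto simp: sign_def finite_permutations)
  have "coeff (q d a) (det_degree d) = (\<Sum>p | p permutes {0..<N}. if p = id then 1 else 0)"
    unfolding q coeff_sum using t by (intro sum.cong) (auto simp: sign_def)
  also have "\<dots> = 1"
    by (simp add: sum.delta finite_permutations permutes_id)
  finally have "coeff (q d a) (det_degree d) = 1" .
  with deg show ?thesis
    by (metis le_degree order_antisym zero_neq_one)
qed

lemma poly_det_indet:
  "poly (Determinant.det (taylor_mat d (indet_fps (d + 1) a))) (of_real x) =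
   Determinant.det (taylor_mat d (coeff_fps (a(d + 1 := x))))"
proof -
  have *: "poly (taylor_mat d (indet_fps (d + 1) a) $$ (m, n)) (of_real x) =
      taylor_mat d (coeff_fps (a(d + 1 := x))) $$ (m, n)" if "m < (d + 1)\<^sup>2" "n < (d + 1)\<^sup>2" for m n
    using that by (simp add: taylor_mat_def poly_indet_fps_power)
  show ?thesis
    unfolding det_taylor_mat poly_sum poly_mult poly_prod
  proof (intro sum.cong[OF refl] arg_cong2[of _ _ _ _ "(*)"] prod.cong[OF refl])
    fix p n assume "p \<in> {p. p permutes {0..<(d + 1)\<^sup>2}}" "n \<in> {0..<(d + 1)\<^sup>2}"
    then show "poly (taylor_mat d (indet_fps (d + 1) a) $$ (p n, n)) (of_real x) =
        taylor_mat d (coeff_fps (a(d + 1 := x))) $$ (p n, n)"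
      using permutes_in_image[of p "{0..<(d + 1)\<^sup>2}" n] by (intro *) auto
  qed (auto simp: sign_def)
qed

section \<open>Size of entries, determinants and adjugates\<close>

lemma norm_coeff_fps_power_le:
  assumes "\<And>k. \<bar>a k\<bar> \<le> 1"
  shows "norm (fps_nth (coeff_fps a ^ j) m) \<le> real (m + 1) ^ j"
proof (induction j arbitrary: m)
  case 0
  then show ?case by (simp add: fps_one_nth)
next
  case (Suc j)
  have "norm (fps_nth (coeff_fps a ^ Suc j) m) \<le>
      (\<Sum>i=0..m. norm (fps_nth (coeff_fps a) i * fps_nth (coeff_fps a ^ j) (m - i)))"
    by (simp add: fps_mult_nth norm_sum)
  also have "\<dots> \<le> (\<Sum>i=0..m. real (m + 1) ^ j)"
  proof (rule sum_mono)
    fix i assume "i \<in> {0..m}"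
    have "norm (fps_nth (coeff_fps a ^ j) (m - i)) \<le> real (m - i + 1) ^ j" by (rule Suc)
    also have "\<dots> \<le> real (m + 1) ^ j" by (intro power_mono) auto
    finally have "norm (fps_nth (coeff_fps a) i) * norm (fps_nth (coeff_fps a ^ j) (m - i)) \<le>
        1 * real (m + 1) ^ j"
      using assms by (intro mult_mono) (auto simp: coeff_fps_def)
    then show "norm (fps_nth (coeff_fps a) i * fps_nth (coeff_fps a ^ j) (m - i)) \<le> real (m + 1) ^ j"
      by (simp add: norm_mult)
  qed
  also have "\<dots> = real (m + 1) ^ Suc j" by simp
  finally show ?case .
qed

lemma norm_det_le:
  fixes A :: "complex mat"
  assumes A: "A \<in> carrier_mat n n" and K: "\<And>i j. i < n \<Longrightarrow> j < n \<Longrightarrow> norm (A $$ (i, j)) \<le> K"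
  shows "norm (Determinant.det A) \<le> fact n * K ^ n"
proof -
  have "norm (Determinant.det A) \<le>
      (\<Sum>p | p permutes {0..<n}. norm (signof p * (\<Prod>i = 0..<n. A $$ (i, p i))))"
    unfolding det_def'[OF A] by (rule norm_sum)
  also have "\<dots> \<le> (\<Sum>p | p permutes {0..<n}. K ^ n)"
  proof (rule sum_mono)
    fix p assume p: "p \<in> {p. p permutes {0..<n}}"
    have "(\<Prod>i = 0..<n. norm (A $$ (i, p i))) \<le> (\<Prod>i = 0..<n. K)"
      using p by (intro prod_mono conjI K) (auto dest: permutes_in_image)
    then show "norm (signof p * (\<Prod>i = 0..<n. A $$ (i, p i))) \<le> K ^ n"
      by (simp add: norm_mult prod_norm sign_def)
  qed
  also have "\<dots> = fact n * K ^ n"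
    by (simp add: card_permutations[of _ n])
  finally show ?thesis .
qed

lemma adj_mat_bound:
  fixes A :: "complex mat"
  assumes A: "A \<in> carrier_mat n n" and K: "\<And>i j. i < n \<Longrightarrow> j < n \<Longrightarrow> norm (A $$ (i, j)) \<le> K"
    and ij: "i < n" "j < n"
  shows "norm (adj_mat A $$ (i, j)) \<le> fact (n - 1) * K ^ (n - 1)"
proof -
  have "norm (Determinant.det (mat_delete A j i)) \<le> fact (n - 1) * K ^ (n - 1)"
  proof (rule norm_det_le)
    show "mat_delete A j i \<in> carrier_mat (n - 1) (n - 1)" by (rule mat_delete_carrier[OF A])
    show "norm (mat_delete A j i $$ (k, l)) \<le> K" if "k < n - 1" "l < n - 1" for k l
      using A that by (auto simp: mat_delete_def intro!: K)
  qed
  then show ?thesis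
    using A ij by (simp add: adj_mat_def cofactor_def norm_mult norm_power)
qed

text \<open>Multiply \<open>A v = w\<close> by the adjugate matrix.\<close>

lemma ex_large_image_coord:
  fixes A :: "complex mat" and v :: "nat \<Rightarrow> complex"
  assumes A: "A \<in> carrier_mat n n" and K: "\<And>i j. i < n \<Longrightarrow> j < n \<Longrightarrow> norm (A $$ (i, j)) \<le> K"
    and k: "k < n"
  shows "\<exists>m<n. norm (Determinant.det A) * norm (v k) \<le>
           fact n * K ^ (n - 1) * norm (\<Sum>j<n. A $$ (m, j) * v j)"
proof -
  define w where "w m = (\<Sum>j<n. A $$ (m, j) * v j)" for m
  define V where "V = Matrix.vec n v"
  have V: "V \<in> carrier_vec n" by (simp add: V_def)
  have AV: "A *\<^sub>v V = Matrix.vec n w"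
    using A by (intro eq_vecI) (auto simp: w_def V_def scalar_prod_def atLeast0LessThan)
  have K0: "0 \<le> K" using K[OF k k] norm_ge_zero order_trans by blast
  have adj: "adj_mat A \<in> carrier_mat n n" "adj_mat A * A = Determinant.det A \<cdot>\<^sub>m 1\<^sub>m n"
    using adj_mat[OF A] by auto
  have "adj_mat A *\<^sub>v Matrix.vec n w = (Determinant.det A \<cdot>\<^sub>m 1\<^sub>m n) *\<^sub>v V"
    using assoc_mult_mat_vec[OF adj(1) A V] adj(2) AV by simp
  then have "vec_index (adj_mat A *\<^sub>v Matrix.vec n w) k = vec_index ((Determinant.det A \<cdot>\<^sub>m 1\<^sub>m n) *\<^sub>v V) k"
    by simp
  moreover have "vec_index ((Determinant.det A \<cdot>\<^sub>m 1\<^sub>m n) *\<^sub>v V) k = Determinant.det A * v k"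
    using k by (simp add: V_def scalar_prod_def if_distrib if_distribR sum.delta cong: if_cong)
  moreover have "vec_index (adj_mat A *\<^sub>v Matrix.vec n w) k = (\<Sum>m<n. adj_mat A $$ (k, m) * w m)"
    using adj(1) k by (auto simp: scalar_prod_def atLeast0LessThan)
  ultimately have eq: "Determinant.det A * v k = (\<Sum>m<n. adj_mat A $$ (k, m) * w m)" by simp
  \<comment> \<open>\<open>W\<close> is the largest coordinate of the image and \<open>m\<close> a
    place where it is attained. The \<open>n\<close> summands turn \<open>fact (n - 1)\<close> into
    \<open>fact n\<close>.\<close>
  define W where "W = Max ((\<lambda>m. norm (w m)) ` {..<n})"
  have ne: "(\<lambda>m. norm (w m)) ` {..<n} \<noteq> {}" using k by auto
  have W: "norm (w m) \<le> W" if "m < n" for m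
    unfolding W_def using that by (intro Max_ge) auto
  from Max_in[OF _ ne] obtain m where m: "m < n" "W = norm (w m)"
    unfolding W_def by auto
  have "norm (Determinant.det A) * norm (v k) = norm (\<Sum>m<n. adj_mat A $$ (k, m) * w m)"
    by (metis eq norm_mult)
  also have "\<dots> \<le> (\<Sum>m<n. norm (adj_mat A $$ (k, m) * w m))" by (rule norm_sum)
  also have "\<dots> \<le> (\<Sum>m<n. fact (n - 1) * K ^ (n - 1) * W)"
    using W adj_mat_bound[OF A K k] K0
    by (intro sum_mono) (auto simp: norm_mult intro!: mult_mono)
  also have "\<dots> = fact n * K ^ (n - 1) * norm (w m)"
    using k m(2) by (simp add: fact_reduce[of n])
  finally show ?thesis using m(1) unfolding w_def by blast
qed

section \<open>Small values of the determinant\<close>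

text \<open>The value of a monic polynomial is the product of the distances to its roots; if all
  distances exceed \<open>s\<close>, the product exceeds \<open>s ^ degree q\<close>. This strict
  inequality needs at least one root, hence the positive degree.\<close>

lemma monic_small_value_root:
  fixes q :: "complex poly"
  assumes q: "lead_coeff q = 1" and s: "s > 0"
  obtains R :: "complex set" where "finite R" "card R \<le> degree q"
    "\<And>z. norm (poly q z) \<le> s ^ degree q \<Longrightarrow> degree q > 0 \<Longrightarrow> \<exists>r\<in>R. norm (z - r) \<le> s"
proof -
  have "q \<noteq> 0" using q by auto
  from alg_closed_imp_factorization[OF this] q obtain A
    where A: "size A = degree q" "q = (\<Prod>x\<in>#A. [:-x, 1:])" by auto
  show thesis
  proof (rule that[of "set_mset A"])
    have "card (set_mset A) \<le> size A"
      using size_mset_mono[OF mset_set_set_mset_msubset[of A]] by simp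
    then show "card (set_mset A) \<le> degree q" using A(1) by simp
    fix z assume z: "norm (poly q z) \<le> s ^ degree q" and d: "degree q > 0"
    show "\<exists>r\<in>set_mset A. norm (z - r) \<le> s"
    proof (rule ccontr)
      assume "\<not> ?thesis"
      then have far: "s < norm (z - r)" if "r \<in># A" for r using that by force
      have *: "norm (poly (\<Prod>x\<in>#A. [:-x, 1:]) z) = (\<Prod>x\<in>#A. norm (z - x))"
        by (induction A) (simp_all add: norm_mult flip: left_diff_distrib)
      have "A \<noteq> {#} \<Longrightarrow> s ^ size A < (\<Prod>x\<in>#A. norm (z - x))" using far
      proof (induction A)
        case (add x A)
        show ?case
        proof (cases "A = {#}")
          case False
          then have "s ^ size A < (\<Prod>x\<in>#A. norm (z - x))" "s < norm (z - x)" using add by auto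
          then show ?thesis using s by (auto intro!: mult_strict_mono)
        qed (use add in auto)
      qed auto
      moreover have "A \<noteq> {#}" using A d by auto
      ultimately show False using z * A by simp
    qed
  qed simp
qed

section \<open>The uniform distribution on the interval\<close>

lemma sets_unif_I: "sets unif_I = sets (restrict_space borel {-1..1})"
  unfolding unif_I_def by (rule sets_restrict_space_cong) simp

lemma space_unif_I: "space unif_I = {-1..1}"
  by (simp add: unif_I_def space_restrict_space)

lemma sets_unif_I_Int: "A \<in> sets borel \<Longrightarrow> A \<inter> {-1..1} \<in> sets unif_I"
  unfolding sets_unif_I sets_restrict_space by (metis Int_commute imageI)

lemma borel_measurable_unif_I: "f \<in> borel_measurable borel \<Longrightarrow> f \<in> borel_measurable unif_I"
  using measurable_restrict_space1[of f borel borel "{-1..1}"]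
  unfolding measurable_cong_sets[OF sets_unif_I refl] .

lemma emeasure_unif_I:
  assumes "A \<in> sets borel"
  shows "emeasure unif_I (A \<inter> {-1..1}) = emeasure lborel (A \<inter> {-1..1}) / 2"
  using assms unfolding unif_I_def
  by (subst emeasure_restrict_space) (auto simp: Int_absorb1)

lemma emeasure_unif_I_interval_le:
  assumes "c \<le> (d::real)"
  shows "emeasure unif_I ({c..d} \<inter> {-1..1}) \<le> ennreal ((d - c) / 2)"
proof -
  have "emeasure unif_I ({c..d} \<inter> {-1..1}) \<le> emeasure lborel {c..d} / 2"
    by (subst emeasure_unif_I) (auto intro!: divide_right_mono_ennreal emeasure_mono)
  also have "\<dots> = ennreal ((d - c) / 2)" using assms
    by (simp add: divide_ennreal[symmetric])
  finally show ?thesis .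
qed

text \<open>A real point within \<open>s\<close> of a complex root \<open>r\<close> is within
  \<open>s\<close> of \<open>Re r\<close>. So the set is covered by at most \<open>degree q\<close>
  intervals of length \<open>2 * s\<close>, and the density 1/2 gives each of them probability at
  most \<open>s\<close>.\<close>

lemma emeasure_unif_I_small_poly:
  fixes q :: "complex poly"
  assumes q: "lead_coeff q = 1" "degree q > 0" and s: "s > 0"
  shows "emeasure unif_I {x \<in> {-1..1}. norm (poly q (of_real x)) \<le> s ^ degree q}
    \<le> ennreal (s * degree q)"
proof -
  obtain R :: "complex set" where R: "finite R" "card R \<le> degree q"
    "\<And>z. norm (poly q z) \<le> s ^ degree q \<Longrightarrow> \<exists>r\<in>R. norm (z - r) \<le> s"
    using monic_small_value_root[OF q(1) s] q(2) by metis
  let ?J = "\<lambda>r. {Re r - s..Re r + s} \<inter> {-1..1}"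
  have J: "emeasure unif_I (?J r) \<le> ennreal s" for r
    using emeasure_unif_I_interval_le[of "Re r - s" "Re r + s"] s by simp
  have "{x \<in> {-1..1}. norm (poly q (of_real x)) \<le> s ^ degree q} \<subseteq> (\<Union>r\<in>R. ?J r)"
  proof safe
    fix x :: real assume x: "x \<in> {-1..1}" "norm (poly q (of_real x)) \<le> s ^ degree q"
    from R(3)[OF x(2)] obtain r where r: "r \<in> R" "norm (of_real x - r) \<le> s" by blast
    have "\<bar>x - Re r\<bar> \<le> s" using abs_Re_le_cmod[of "of_real x - r"] r by simp
    with r x show "x \<in> (\<Union>r\<in>R. ?J r)" by (auto simp: abs_le_iff intro!: bexI[of _ r])
  qed
  moreover have JM: "?J r \<in> sets unif_I" for r
    by (rule sets_unif_I_Int) simp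
  ultimately have "emeasure unif_I {x \<in> {-1..1}. norm (poly q (of_real x)) \<le> s ^ degree q} \<le>
      emeasure unif_I (\<Union>r\<in>R. ?J r)"
    using R(1) by (intro emeasure_mono sets.finite_UN) blast+
  also have "\<dots> \<le> (\<Sum>r\<in>R. emeasure unif_I (?J r))"
    using R(1) JM by (intro emeasure_subadditive_finite) blast+
  also have "\<dots> \<le> (\<Sum>r\<in>R. ennreal s)"
    by (intro sum_mono J)
  also have "\<dots> = ennreal (s * card R)"
    using s by (simp add: ennreal_mult mult.commute ennreal_of_nat_eq_real_of_nat)
  also have "\<dots> \<le> ennreal (s * degree q)"
    using R(2) s by (intro ennreal_leI) (auto intro: mult_left_mono)
  finally show ?thesis .
qed

section \<open>Resampling one coefficient of the random series\<close>

lemma measurable_coeff: "(\<lambda>a. a k) \<in> borel_measurable coeff_measure"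
proof -
  have "(\<lambda>a. a k) \<in> measurable coeff_measure unif_I"
    unfolding coeff_measure_def by (rule measurable_component_singleton) simp
  moreover have "(\<lambda>x. x) \<in> borel_measurable unif_I" by (rule borel_measurable_unif_I) simp
  ultimately show ?thesis using measurable_compose by blast
qed

lemma coeff_measure_abs_le: "a \<in> space coeff_measure \<Longrightarrow> \<bar>a k\<bar> \<le> 1"
  unfolding space_coeff_measure by (drule CollectD, drule spec[of _ k]) auto

text \<open>Replacing coordinate \<open>k\<close> by an independent uniform sample preserves the
  product measure, so by Fubini a uniform bound on the one-dimensional slices bounds the whole
  set.\<close>

lemma emeasure_coeff_measure_resample:
  assumes A: "A \<in> sets coeff_measure"
    and le: "\<And>a. a \<in> space coeff_measure \<Longrightarrow>
      emeasure unif_I {x \<in> {-1..1}. a(k := x) \<in> A} \<le> c"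
  shows "emeasure coeff_measure A \<le> c"
proof -
  interpret U: prob_space unif_I by (rule prob_space_unif_I)
  interpret M: prob_space coeff_measure by (rule prob_space_coeff_measure)
  interpret P: pair_sigma_finite unif_I coeff_measure ..
  let ?T = "\<lambda>(x, a). a(k := x) :: nat \<Rightarrow> real"
  have ins: "insert k UNIV = (UNIV :: nat set)" by auto
  \<comment> \<open>The index \<open>k\<close> already lies in \<open>UNIV\<close>, so its old value
    is overwritten rather than a new coordinate adjoined.\<close>
  have eq: "distr (unif_I \<Otimes>\<^sub>M coeff_measure) coeff_measure ?T = coeff_measure"
    using distr_pair_PiM_eq_PiM[of UNIV "\<lambda>_. unif_I" k] prob_space_unif_I
    unfolding coeff_measure_def ins by simp
  have T: "?T \<in> measurable (unif_I \<Otimes>\<^sub>M coeff_measure) coeff_measure"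
    using measurable_add_dim[of k UNIV "\<lambda>_. unif_I"] unfolding coeff_measure_def ins
    by measurable
  have "emeasure coeff_measure A =
      emeasure (unif_I \<Otimes>\<^sub>M coeff_measure) (?T -` A \<inter> space (unif_I \<Otimes>\<^sub>M coeff_measure))"
    by (subst eq[symmetric]) (rule emeasure_distr[OF T A])
  also have "\<dots> = (\<integral>\<^sup>+ a. emeasure unif_I ((\<lambda>x. (x, a)) -`
      (?T -` A \<inter> space (unif_I \<Otimes>\<^sub>M coeff_measure))) \<partial>coeff_measure)"
    by (rule P.emeasure_pair_measure_alt2) (rule measurable_sets[OF T A])
  also have "\<dots> \<le> (\<integral>\<^sup>+ a. c \<partial>coeff_measure)"
  proof (rule nn_integral_mono)
    fix a assume a: "a \<in> space coeff_measure"
    have "(\<lambda>x. (x, a)) -` (?T -` A \<inter> space (unif_I \<Otimes>\<^sub>M coeff_measure)) = {x \<in> {-1..1}. a(k := x) \<in> A}"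
      using a by (auto simp: space_pair_measure space_unif_I)
    then show "emeasure unif_I ((\<lambda>x. (x, a)) -` (?T -` A \<inter> space (unif_I \<Otimes>\<^sub>M coeff_measure))) \<le> c"
      using le[OF a] by simp
  qed
  also have "\<dots> = c" by (simp add: M.emeasure_space_1)
  finally show ?thesis .
qed

lemma measurable_coeff_fps_power:
  "(\<lambda>a. fps_nth (coeff_fps a ^ j) m) \<in> borel_measurable coeff_measure"
proof (induction j arbitrary: m)
  case 0
  then show ?case by simp
next
  case (Suc j)
  have "(\<lambda>a. fps_nth (coeff_fps a) i) \<in> borel_measurable coeff_measure" for i
    unfolding coeff_fps_def using measurable_coeff[of i] by simp
  with Suc show ?case by (auto simp: fps_mult_nth intro!: borel_measurable_sum borel_measurable_times)
qed

lemma measurable_det_taylor_mat: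
  "(\<lambda>a. Determinant.det (taylor_mat d (coeff_fps a))) \<in> borel_measurable coeff_measure"
proof -
  have "(\<lambda>a. taylor_mat d (coeff_fps a) $$ (i, j)) \<in> borel_measurable coeff_measure"
    if "i < (d + 1)\<^sup>2" "j < (d + 1)\<^sup>2" for i j
    using that measurable_coeff_fps_power by (auto simp: taylor_mat_def)
  then show ?thesis
    unfolding det_taylor_mat
    by (intro borel_measurable_sum borel_measurable_times borel_measurable_prod borel_measurable_const)
       (auto dest: permutes_in_image)
qed

lemma emeasure_small_det:
  assumes d: "d \<ge> 1" and s: "s > 0"
  shows "emeasure coeff_measure {a \<in> space coeff_measure.
      norm (Determinant.det (taylor_mat d (coeff_fps a))) \<le> s ^ det_degree d}
    \<le> ennreal (s * det_degree d)"
proof (rule emeasure_coeff_measure_resample[where k = "d + 1"])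
  show "{a \<in> space coeff_measure. norm (Determinant.det (taylor_mat d (coeff_fps a)))
      \<le> s ^ det_degree d} \<in> sets coeff_measure"
    using measurable_det_taylor_mat[of d] by measurable
next
  fix a assume a: "a \<in> space coeff_measure"
  define q where "q = Determinant.det (taylor_mat d (indet_fps (d + 1) a))"
  have q: "degree q = det_degree d" "lead_coeff q = 1"
    using monic_det_indet[of d a] unfolding q_def by auto
  have "{x \<in> {-1..1}. a(d + 1 := x) \<in> {a \<in> space coeff_measure.
      norm (Determinant.det (taylor_mat d (coeff_fps a))) \<le> s ^ det_degree d}} =
      {x \<in> {-1..1}. norm (poly q (of_real x)) \<le> s ^ degree q}"
    using a unfolding q(1) unfolding q_def poly_det_indet by (auto simp: space_coeff_measure)
  then show "emeasure unif_I {x \<in> {-1..1}. a(d + 1 := x) \<in> {a \<in> space coeff_measure.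
      norm (Determinant.det (taylor_mat d (coeff_fps a))) \<le> s ^ det_degree d}} \<le> ennreal (s * det_degree d)"
    using emeasure_unif_I_small_poly[OF q(2) _ s] det_degree_pos[OF d] q(1) by simp
qed

text \<open>The thresholds make the exceptional set for \<open>d\<close> have probability at most \<open>e / 2 ^ d\<close>.\<close>

definition good_set :: "real \<Rightarrow> (nat \<Rightarrow> real) set" where
  "good_set e = {a \<in> space coeff_measure. \<forall>d\<ge>1. (e / (det_degree d * 2 ^ d)) ^ det_degree d <
     norm (Determinant.det (taylor_mat d (coeff_fps a)))}"

text \<open>Union bound over the exceptional sets for all \<open>d \<ge> 1\<close>, with a geometric
  series of total \<open>e\<close>.\<close>

lemma measure_good_set:
  assumes e: "e > 0"
  shows "good_set e \<in> sets coeff_measure" "measure coeff_measure (good_set e) \<ge> 1 - e"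
proof -
  interpret M: prob_space coeff_measure by (rule prob_space_coeff_measure)
  show meas: "good_set e \<in> sets coeff_measure"
    unfolding good_set_def using measurable_det_taylor_mat by measurable
  define B where "B n = {a \<in> space coeff_measure.
     norm (Determinant.det (taylor_mat (Suc n) (coeff_fps a))) \<le>
     (e / (det_degree (Suc n) * 2 ^ (Suc n))) ^ det_degree (Suc n)}" for n
  have B: "B n \<in> sets coeff_measure" for n
    unfolding B_def using measurable_det_taylor_mat[of "Suc n"] by measurable
  have le: "emeasure coeff_measure (B n) \<le> ennreal (e * (1/2) ^ Suc n)" for n
  proof -
    have D: "det_degree (Suc n) > 0" by (rule det_degree_pos) simp
    have "emeasure coeff_measure (B n) \<le>
       ennreal (e / (det_degree (Suc n) * 2 ^ (Suc n)) * det_degree (Suc n))"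
      unfolding B_def using e D by (intro emeasure_small_det) auto
    \<comment> \<open>The factor \<open>det_degree\<close> in the threshold cancels the number of
      roots, leaving a summable bound.\<close>
    also have "e / (det_degree (Suc n) * 2 ^ (Suc n)) * det_degree (Suc n) = e * (1/2) ^ Suc n"
      using D by (simp add: field_simps power_divide)
    finally show ?thesis .
  qed
  have "space coeff_measure - good_set e \<subseteq> (\<Union>n. B n)"
  proof
    fix a assume "a \<in> space coeff_measure - good_set e"
    then obtain d where d: "d \<ge> 1" "a \<in> space coeff_measure"
      "norm (Determinant.det (taylor_mat d (coeff_fps a))) \<le> (e / (det_degree d * 2 ^ d)) ^ det_degree d"
      by (auto simp: good_set_def not_less)
    from d(1) obtain n where "d = Suc n" by (cases d) auto
    with d have "a \<in> B n" by (simp add: B_def)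
    then show "a \<in> (\<Union>n. B n)" by blast
  qed
  then have "emeasure coeff_measure (space coeff_measure - good_set e) \<le> emeasure coeff_measure (\<Union>n. B n)"
    using B by (intro emeasure_mono) auto
  also have "\<dots> \<le> (\<Sum>n. emeasure coeff_measure (B n))"
    using B by (intro emeasure_subadditive_countably) auto
  also have "\<dots> \<le> (\<Sum>n. ennreal (e * (1/2) ^ Suc n))"
    using le by (intro suminf_le) auto
  also have "\<dots> = ennreal e"
  proof (rule suminf_ennreal_eq)
    show "(\<lambda>n. e * (1/2) ^ Suc n) sums e"
      using sums_mult[OF power_half_series, of e] by simp
  qed (use e in auto)
  finally have "measure coeff_measure (space coeff_measure - good_set e) \<le> e"
    using e by (simp add: M.emeasure_eq_measure)
  then show "measure coeff_measure (good_set e) \<ge> 1 - e"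
    using M.prob_compl[OF meas] by simp
qed

text \<open>Good sets have probability at least \<open>p\<close>, whereas exactly \<open>p\<close>
  is required. Cutting \<open>G\<close> by \<open>a 0 \<le> t\<close> gives a measure that varies
  continuously with \<open>t\<close>, and the intermediate value theorem applies.\<close>

lemma ex_subset_of_measure:
  assumes G: "G \<in> sets coeff_measure" and p: "0 < p" "p \<le> measure coeff_measure G"
  shows "\<exists>E\<in>sets coeff_measure. E \<subseteq> G \<and> measure coeff_measure E = p"
proof -
  interpret M: prob_space coeff_measure by (rule prob_space_coeff_measure)
  define H where "H t = G \<inter> {a \<in> space coeff_measure. a 0 \<le> t}" for t
  have H: "H t \<in> sets coeff_measure" for t
    unfolding H_def using G measurable_coeff[of 0] by measurable
  define h where "h t = measure coeff_measure (H t)" for t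
  \<comment> \<open>Raising the cut from \<open>s\<close> to \<open>t\<close> adds only points with
    \<open>a 0\<close> in \<open>{s..t}\<close>, a set of probability at most half the
    length.\<close>
  have inc: "h t - h s \<le> (t - s) / 2" "h s \<le> h t" if "s \<le> t" for s t
  proof -
    let ?A = "{a \<in> space coeff_measure. a 0 \<in> {s..t}}"
    have A: "?A \<in> sets coeff_measure" using measurable_coeff[of 0] by measurable
    have "emeasure coeff_measure ?A \<le> ennreal ((t - s) / 2)"
    proof (rule emeasure_coeff_measure_resample[OF A, where k = 0])
      fix a assume "a \<in> space coeff_measure"
      then have "{x \<in> {-1..1}. a(0 := x) \<in> ?A} = {s..t} \<inter> {-1..1}"
        by (auto simp: space_coeff_measure)
      then show "emeasure unif_I {x \<in> {-1..1}. a(0 := x) \<in> ?A} \<le> ennreal ((t - s) / 2)"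
        using emeasure_unif_I_interval_le[OF that] by simp
    qed
    then have "measure coeff_measure ?A \<le> (t - s) / 2"
      using that by (simp add: M.emeasure_eq_measure)
    moreover have "h t \<le> measure coeff_measure (H s \<union> ?A)"
      unfolding h_def using H A by (intro M.finite_measure_mono) (auto simp: H_def)
    moreover have "measure coeff_measure (H s \<union> ?A) \<le> h s + measure coeff_measure ?A"
      unfolding h_def by (rule measure_Un_le[OF H A])
    ultimately show "h t - h s \<le> (t - s) / 2" by linarith
    show "h s \<le> h t"
      unfolding h_def using H that by (intro M.finite_measure_mono) (auto simp: H_def)
  qed
  have lip: "\<bar>h t - h s\<bar> \<le> \<bar>t - s\<bar>" for s t
    using inc[of s t] inc[of t s] by (cases "s \<le> t") auto
  have cont: "isCont h t" for t
  proof -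
    have "1-lipschitz_on UNIV h"
      by (rule lipschitz_onI) (use lip in \<open>auto simp: dist_real_def\<close>)
    then have "continuous_on UNIV h" by (rule lipschitz_on_continuous_on)
    then show ?thesis by (simp add: continuous_on_eq_continuous_at)
  qed
  \<comment> \<open>The endpoint -2 lies strictly below all coefficients, so the cut set is empty
    and not merely null.\<close>
  have "H (-2) = {}"
    using coeff_measure_abs_le[of _ 0] by (fastforce simp: H_def)
  then have h0: "h (-2) = 0" by (simp add: h_def)
  have "H 1 = G"
    using sets.sets_into_space[OF G] by (auto simp: H_def space_coeff_measure)
  then have h1: "h 1 = measure coeff_measure G" by (simp add: h_def)
  obtain t where "h t = p"
    using IVT[of h "-2" p 1] h0 h1 p cont by auto
  then show ?thesis using H by (intro bexI[of _ "H t"]) (auto simp: h_def H_def)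
qed

section \<open>Zeroes and Taylor coefficients\<close>

text \<open>The quotient by the power of \<open>z - w\<close> is holomorphic away from
  \<open>w\<close> and agrees near \<open>w\<close> with the local factor
  \<open>zor_poly F w\<close>. Gluing both extends the local factorization to all of
  \<open>S\<close>.\<close>

lemma holomorphic_factor_zorder:
  assumes F: "F holomorphic_on S" and S: "open S" "connected S" and w: "w \<in> S"
    and nz: "\<exists>z\<in>S. F z \<noteq> 0"
  shows "\<exists>H. H holomorphic_on S \<and> H w \<noteq> 0 \<and> (\<forall>z\<in>S. F z = (z - w) ^ nat (zorder F w) * H z)"
proof -
  define n where "n = nat (zorder F w)"
  define g where "g = zor_poly F w"
  obtain r where r: "r > 0" "cball w r \<subseteq> S" "g holomorphic_on cball w r"
     "\<And>z. z \<in> cball w r \<Longrightarrow> F z = g z * (z - w) ^ n \<and> g z \<noteq> 0"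
    using zorder_exist_zero[OF F S w nz] unfolding n_def g_def by blast
  define H where "H z = (if z = w then g w else F z / (z - w) ^ n)" for z
  have "H holomorphic_on (S - {w}) \<union> ball w r"
  proof (rule holomorphic_on_Un)
    have "(\<lambda>z. F z / (z - w) ^ n) holomorphic_on S - {w}"
      using F by (auto intro!: holomorphic_intros intro: holomorphic_on_subset)
    then show "H holomorphic_on S - {w}"
      by (rule holomorphic_transform) (auto simp: H_def)
    have "g holomorphic_on ball w r" using r(3) by (rule holomorphic_on_subset) auto
    then show "H holomorphic_on ball w r"
      by (rule holomorphic_transform) (use r(4) in \<open>auto simp: H_def\<close>)
  qed (use S in auto)
  moreover have "(S - {w}) \<union> ball w r = S"
  proof -
    have "ball w r \<subseteq> S" using r(2) ball_subset_cball by blast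
    moreover have "w \<in> ball w r" using r(1) by simp
    ultimately show ?thesis by blast
  qed
  ultimately have "H holomorphic_on S" by simp
  moreover have "H w \<noteq> 0" using r by (simp add: H_def)
  moreover have "F z = (z - w) ^ n * H z" if "z \<in> S" for z
    using r by (cases "z = w") (auto simp: H_def)
  ultimately show ?thesis unfolding n_def by blast
qed

text \<open>The points are divided out one by one. The cofactor left after some points has the same
  order as \<open>F\<close> at a new point, because the factors already removed do not vanish
  there.\<close>

lemma holomorphic_factor_zeros:
  assumes F: "F holomorphic_on S" and S: "open S" "connected S" and nz: "\<exists>z\<in>S. F z \<noteq> 0"
    and Z: "finite Z" "Z \<subseteq> S"
  shows "\<exists>G. G holomorphic_on S \<and> (\<forall>z\<in>S. F z = G z * (\<Prod>w\<in>Z. (z - w) ^ nat (zorder F w)))"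
  using Z
proof (induction Z rule: finite_induct)
  case empty
  then show ?case using F by auto
next
  case (insert w Z)
  define P where "P z = (\<Prod>v\<in>Z. (z - v) ^ nat (zorder F v))" for z
  from insert obtain G where G: "G holomorphic_on S" "\<And>z. z \<in> S \<Longrightarrow> F z = G z * P z"
    unfolding P_def by auto
  have "\<exists>z\<in>S. G z \<noteq> 0" using nz G(2) by fastforce
  then obtain H where H: "H holomorphic_on S" "H w \<noteq> 0"
      "\<And>z. z \<in> S \<Longrightarrow> G z = (z - w) ^ nat (zorder G w) * H z"
    using holomorphic_factor_zorder[OF G(1) S, of w] insert.prems by auto
  have "zorder F w = int (nat (zorder G w))"
  proof (rule zorder_eqI)
    show "(\<lambda>z. H z * P z) holomorphic_on S"
      using H(1) unfolding P_def by (auto intro!: holomorphic_intros)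
    show "H w * P w \<noteq> 0" using H(2) insert.hyps by (auto simp: P_def)
    show "F z = H z * P z * (z - w) powi int (nat (zorder G w))" if "z \<in> S" for z
      unfolding power_int_of_nat using that G(2) H(3) by simp
  qed (use S insert.prems in auto)
  then have k: "nat (zorder F w) = nat (zorder G w)" by simp
  have "F z = H z * (\<Prod>v\<in>insert w Z. (z - v) ^ nat (zorder F v))" if "z \<in> S" for z
    using that G(2) H(3) insert.hyps by (simp add: k P_def mult_ac)
  with H(1) show ?case by blast
qed

text \<open>Dividing out the zeroes costs a factor \<open>1/2\<close> for each of them on the circle of radius \<open>3/4\<close>;
  multiplying them back gains a factor \<open>3/8\<close> on \<open>cball 0 (1/8)\<close>.\<close>

lemma zero_count_le:
  fixes F :: "complex \<Rightarrow> complex"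
  assumes F: "F holomorphic_on ball 0 1"
    and B: "\<And>z. norm z = 3/4 \<Longrightarrow> norm (F z) \<le> B"
    and m: "(deriv ^^ m) F 0 \<noteq> 0"
  shows "\<exists>n. zero_count F (cball 0 (1/4)) = enat n \<and>
    norm ((deriv ^^ m) F 0) / fact m \<le> B * (3/4) ^ n * 8 ^ m"
proof -
  let ?S = "ball 0 1 :: complex set"
  define Z where "Z = {z \<in> cball 0 (1/4). F z = 0}"
  \<comment> \<open>A nonzero derivative excludes the zero function, whose zero count would be
    infinite.\<close>
  have nz: "\<exists>z\<in>?S. F z \<noteq> 0"
  proof (rule ccontr)
    assume "\<not> ?thesis"
    then have z: "F z = 0" if "z \<in> ?S" for z using that by auto
    have "(deriv ^^ m) F 0 = (deriv ^^ m) (\<lambda>_. 0) 0"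
      using F z by (intro higher_deriv_transform_within_open[of _ ?S]) auto
    also have "\<dots> = 0" by simp
    finally show False using m by simp
  qed
  have Z: "finite Z"
  proof -
    have sub: "cball 0 (1/4) \<subseteq> ?S" by auto
    show ?thesis
    proof (cases "F constant_on ?S")
      case True
      then have "Z = {}" using nz sub unfolding Z_def constant_on_def by fastforce
      then show ?thesis by simp
    next
      case False
      then show ?thesis
        unfolding Z_def by (intro holomorphic_compact_finite_zeros[OF F _ _ _ sub]) auto
    qed
  qed
  define n where "n = (\<Sum>z\<in>Z. nat (zorder F z))"
  have zc: "zero_count F (cball 0 (1/4)) = enat n"
    using Z unfolding zero_count_def Z_def n_def by simp
  have ZS: "Z \<subseteq> ?S" by (auto simp: Z_def)
  obtain G where G: "G holomorphic_on ?S"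
      "\<And>z. z \<in> ?S \<Longrightarrow> F z = G z * (\<Prod>w\<in>Z. (z - w) ^ nat (zorder F w))"
    using holomorphic_factor_zeros[OF F _ _ nz Z ZS] by auto
  have Zn: "norm w \<le> 1/4" if "w \<in> Z" for w using that by (simp add: Z_def)
  have bG: "norm (G z) \<le> B * 2 ^ n" if "norm z = 3/4" for z
  proof -
    have "(1/2) ^ n = (\<Prod>w\<in>Z. (1/2::real) ^ nat (zorder F w))"
      by (simp add: n_def power_sum)
    also have "\<dots> \<le> (\<Prod>w\<in>Z. norm (z - w) ^ nat (zorder F w))"
    proof (intro prod_mono conjI power_mono)
      fix w assume "w \<in> Z"
      then show "1/2 \<le> norm (z - w)"
        using that Zn[of w] norm_triangle_ineq2[of z w] by linarith
    qed auto
    finally have "norm (G z) * (1/2) ^ n \<le> norm (G z) * (\<Prod>w\<in>Z. norm (z - w) ^ nat (zorder F w))"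
      by (rule mult_left_mono) auto
    also have "\<dots> = norm (F z)"
      using that by (simp add: G(2) norm_mult norm_power flip: prod_norm)
    also have "\<dots> \<le> B" using B that by blast
    finally show ?thesis by (simp add: power_divide field_simps)
  qed
  \<comment> \<open>The maximum modulus principle carries the bound from the circle to the
    disc.\<close>
  have bG': "norm (G z) \<le> B * 2 ^ n" if "norm z \<le> 3/4" for z
  proof (rule maximum_modulus_frontier[of G "cball 0 (3/4)"])
    show "G holomorphic_on interior (cball 0 (3/4))"
      by (rule holomorphic_on_subset[OF G(1)]) auto
    have "continuous_on (cball 0 (3/4)) G"
      by (rule holomorphic_on_imp_continuous_on, rule holomorphic_on_subset[OF G(1)]) auto
    then show "continuous_on (closure (cball 0 (3/4))) G" by simp
  qed (use that bG in auto)
  have bF: "norm (F z) \<le> B * (3/4) ^ n" if z: "norm z \<le> 1/8" for z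
  proof -
    have "norm (F z) = norm (G z) * (\<Prod>w\<in>Z. norm (z - w) ^ nat (zorder F w))"
      using z by (simp add: G(2) norm_mult norm_power flip: prod_norm)
    also have "\<dots> \<le> (B * 2 ^ n) * (\<Prod>w\<in>Z. (3/8) ^ nat (zorder F w))"
    proof (intro mult_mono prod_mono conjI power_mono)
      show "norm (G z) \<le> B * 2 ^ n" using z by (intro bG') auto
      then show "0 \<le> B * 2 ^ n" using norm_ge_zero order_trans by blast
      fix w assume "w \<in> Z"
      then show "norm (z - w) \<le> 3/8"
        using z Zn[of w] norm_triangle_ineq4[of z w] by linarith
    qed (auto intro!: prod_nonneg)
    also have "(\<Prod>w\<in>Z. (3/8::real) ^ nat (zorder F w)) = (3/8) ^ n"
      by (simp only: n_def power_sum)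
    also have "B * 2 ^ n * (3/8) ^ n = B * (3/4) ^ n"
      using power_mult_distrib[of 2 "3/8::real" n] by simp
    finally show ?thesis .
  qed
  \<comment> \<open>Cauchy's inequality on the circle of radius 1/8 is the source of the factor
    \<open>8 ^ m\<close>.\<close>
  have "norm ((deriv ^^ m) F 0) \<le> fact m * (B * (3/4) ^ n) / (1/8) ^ m"
  proof (rule Cauchy_inequality)
    show "F holomorphic_on ball 0 (1/8)" by (rule holomorphic_on_subset[OF F]) auto
    show "continuous_on (cball 0 (1/8)) F"
      by (rule holomorphic_on_imp_continuous_on, rule holomorphic_on_subset[OF F]) auto
  qed (use bF in auto)
  then show ?thesis using zc by (auto simp: field_simps power_divide)
qed

section \<open>Zeroes of polynomial combinations of the series\<close>

lemma summable_series_fun: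
  assumes a: "\<And>k. \<bar>a k\<bar> \<le> 1" and z: "norm (z :: complex) < 1"
  shows "summable (\<lambda>k. norm (of_real (a k) * z ^ k))"
proof (rule summable_comparison_test')
  show "summable (\<lambda>k. norm z ^ k)" using z by simp
  show "norm (norm (of_real (a k) * z ^ k)) \<le> norm z ^ k" for k
    using a[of k] by (auto simp: norm_mult norm_power intro: mult_left_le_one_le)
qed

text \<open>Bounded coefficients force radius of convergence at least 1. The expansion lets formal
  powers of \<open>coeff_fps a\<close> stand for Taylor coefficients.\<close>

lemma series_fun_expansion:
  assumes a: "\<And>k. \<bar>a k\<bar> \<le> 1"
  shows "series_fun a has_fps_expansion coeff_fps a"
    and "series_fun a holomorphic_on ball 0 1"
proof -
  have eq: "series_fun a = eval_fps (coeff_fps a)"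
    by (simp add: fun_eq_iff series_fun_def eval_fps_def coeff_fps_def)
  have cr: "fps_conv_radius (coeff_fps a) \<ge> 1"
    unfolding fps_conv_radius_def
  proof (rule conv_radius_geI_ex')
    fix r :: real assume r: "0 < r" "ereal r < 1"
    then have "norm (of_real r :: complex) < 1" by simp
    from summable_series_fun[OF a this] show "summable (\<lambda>k. fps_nth (coeff_fps a) k * of_real r ^ k)"
      by (auto simp: coeff_fps_def intro: summable_norm_cancel)
  qed
  then have "0 < fps_conv_radius (coeff_fps a)"
    by (rule less_le_trans[rotated]) simp
  then show "series_fun a has_fps_expansion coeff_fps a"
    unfolding eq has_fps_expansion_def by simp
  have "ball 0 1 \<subseteq> eball (0::complex) (fps_conv_radius (coeff_fps a))"
  proof
    fix z :: complex assume "z \<in> ball 0 1"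
    then have "ereal (norm z) < 1" by simp
    also note cr
    finally show "z \<in> eball 0 (fps_conv_radius (coeff_fps a))" by (simp add: in_eball_iff)
  qed
  then show "series_fun a holomorphic_on ball 0 1"
    unfolding eq using holomorphic_on_eval_fps holomorphic_on_subset by blast
qed

lemma norm_series_fun_le:
  assumes a: "\<And>k. \<bar>a k\<bar> \<le> 1" and z: "norm z = 3/4"
  shows "norm (series_fun a z) \<le> 4"
proof -
  have z1: "norm z < 1" using z by simp
  have "norm (series_fun a z) \<le> (\<Sum>k. norm (of_real (a k) * z ^ k))"
    unfolding series_fun_def by (rule summable_norm[OF summable_series_fun[OF a z1]])
  also have "\<dots> \<le> (\<Sum>k. norm z ^ k)"
    using a z1 by (intro suminf_le summable_series_fun)
      (auto simp: norm_mult norm_power intro: mult_left_le_one_le)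
  also have "\<dots> = 4" using z1 by (subst suminf_geometric) (simp_all add: z)
  finally show ?thesis .
qed

lemma div_mod_index:
  assumes "i \<le> (d :: nat)"
  shows "(i + (d + 1) * j) div (d + 1) = j" "(i + (d + 1) * j) mod (d + 1) = i"
  using assms div_mult_self2[of "d + 1" i j] mod_mult_self2[of i "d + 1" j] by auto

text \<open>Writing \<open>n\<close> in base \<open>d + 1\<close> matches the monomials with the
  columns of \<open>taylor_mat\<close>.\<close>

lemma sum_pairs_div_mod:
  fixes d :: nat
  shows "(\<Sum>j\<le>d. \<Sum>i\<le>d. g i j) = (\<Sum>n<(d + 1)\<^sup>2. g (n mod (d + 1)) (n div (d + 1)))"
proof -
  have "(\<Sum>j\<le>d. \<Sum>i\<le>d. g i j) = (\<Sum>(j, i)\<in>{..d} \<times> {..d}. g i j)"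
    by (simp add: sum.cartesian_product)
  also have "\<dots> = (\<Sum>n<(d + 1)\<^sup>2. g (n mod (d + 1)) (n div (d + 1)))"
  proof (rule sum.reindex_bij_witness[where i = "\<lambda>n. (n div (d + 1), n mod (d + 1))"
        and j = "\<lambda>(j, i). i + (d + 1) * j"])
    fix n assume "n \<in> {..<(d + 1)\<^sup>2}"
    then show "(n div (d + 1), n mod (d + 1)) \<in> {..d} \<times> {..d}"
      using less_mult_imp_div_less[of n "d + 1" "d + 1"] mod_less_divisor[of "d + 1" n]
      by (auto simp: power2_eq_square less_Suc_eq_le simp del: mod_less_divisor)
    show "(case (n div (d + 1), n mod (d + 1)) of (j, i) \<Rightarrow> i + (d + 1) * j) = n"
      by (simp only: prod.case mod_mult_div_eq)
  next
    fix p assume "p \<in> {..d} \<times> {..d}"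
    then obtain j i where p: "p = (j, i)" "j \<le> d" "i \<le> d" by auto
    have "i + (d + 1) * j < (d + 1) * (j + 1)" using p by simp
    also have "\<dots> \<le> (d + 1) * (d + 1)" using p by (intro mult_le_mono) auto
    finally show "(case p of (j, i) \<Rightarrow> i + (d + 1) * j) \<in> {..<(d + 1)\<^sup>2}"
      using p by (simp add: power2_eq_square)
    show "((case p of (j, i) \<Rightarrow> i + (d + 1) * j) div (d + 1),
        (case p of (j, i) \<Rightarrow> i + (d + 1) * j) mod (d + 1)) = p"
      "g ((case p of (j, i) \<Rightarrow> i + (d + 1) * j) mod (d + 1))
        ((case p of (j, i) \<Rightarrow> i + (d + 1) * j) div (d + 1)) = (case p of (j, i) \<Rightarrow> g i j)"
      using p(3) by (simp_all only: p(1) prod.case div_mod_index)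
  qed
  finally show ?thesis .
qed

lemma poly_eq_sum_le:
  fixes p :: "'a :: comm_semiring_1 poly"
  assumes "degree p \<le> d"
  shows "poly p z = (\<Sum>i\<le>d. coeff p i * z ^ i)"
proof -
  have "poly p z = (\<Sum>i\<le>degree p. coeff p i * z ^ i)" by (rule poly_altdef)
  also have "\<dots> = (\<Sum>i\<le>d. coeff p i * z ^ i)"
    using assms by (intro sum.mono_neutral_left) (auto simp: coeff_eq_0)
  finally show ?thesis .
qed

text \<open>The adjugate bounds some Taylor coefficient from below and the zeroes bound it from
  above, both in proportion to the largest coefficient \<open>W\<close> of the polynomials.
  \<open>W\<close> cancels, so the result is uniform in \<open>p\<close>.\<close>

lemma zero_count_combination:
  fixes p :: "nat \<Rightarrow> complex poly"
  assumes a: "\<And>k. \<bar>a k\<bar> \<le> 1" and p: "\<And>j. j \<le> d \<Longrightarrow> degree (p j) \<le> d" "\<exists>j\<le>d. p j \<noteq> 0"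
    and det: "\<delta> > 0" "\<delta> \<le> norm (Determinant.det (taylor_mat d (coeff_fps a)))"
  defines "N \<equiv> (d + 1)\<^sup>2"
  shows "\<exists>n. zero_count (\<lambda>z. \<Sum>j\<le>d. poly (p j) z * series_fun a z ^ j) (cball 0 (1/4)) = enat n \<and>
    \<delta> * (4/3) ^ n \<le> real N ^ ((d + 1) * N + 1) * 4 ^ d * 8 ^ N"
proof -
  define F where "F z = (\<Sum>j\<le>d. poly (p j) z * series_fun a z ^ j)" for z
  define v where "v n = coeff (p (n div (d + 1))) (n mod (d + 1))" for n
  define f where "f = coeff_fps a"
  have F: "F z = (\<Sum>n<N. v n * (z ^ (n mod (d + 1)) * series_fun a z ^ (n div (d + 1))))" for z
  proof -
    have "F z = (\<Sum>j\<le>d. \<Sum>i\<le>d. coeff (p j) i * (z ^ i * series_fun a z ^ j))"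
      unfolding F_def
    proof (rule sum.cong[OF refl])
      fix j assume "j \<in> {..d}"
      then have "degree (p j) \<le> d" by (intro p(1)) simp
      then show "poly (p j) z * series_fun a z ^ j =
          (\<Sum>i\<le>d. coeff (p j) i * (z ^ i * series_fun a z ^ j))"
        by (simp only: poly_eq_sum_le sum_distrib_right mult.assoc)
    qed
    then show ?thesis unfolding sum_pairs_div_mod v_def N_def .
  qed
  have exp: "F has_fps_expansion (\<Sum>n<N. fps_const (v n) * (fps_X ^ (n mod (d + 1)) * f ^ (n div (d + 1))))"
    unfolding F[abs_def] f_def using series_fun_expansion(1)[OF a]
    by (intro fps_expansion_intros)
  have deriv: "(deriv ^^ m) F 0 = fact m * (\<Sum>n<N. taylor_mat d f $$ (m, n) * v n)" if "m < N" for m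
  proof -
    have "(deriv ^^ m) F 0 / fact m =
        (\<Sum>n<N. v n * fps_nth (fps_X ^ (n mod (d + 1)) * f ^ (n div (d + 1))) m)"
      using fps_nth_fps_expansion[OF exp, of m] by (simp add: fps_sum_nth)
    also have "\<dots> = (\<Sum>n<N. taylor_mat d f $$ (m, n) * v n)"
      using that by (intro sum.cong refl)
        (auto simp: taylor_mat_def N_def fps_X_power_mult_nth mult_ac)
    finally show ?thesis by (simp add: field_simps)
  qed
  have hol: "F holomorphic_on ball 0 1"
    unfolding F_def using series_fun_expansion(2)[OF a]
    by (intro holomorphic_intros) auto
  have N: "N > 0" by (simp add: N_def)
  define W where "W = Max ((\<lambda>n. norm (v n)) ` {..<N})"
  have W: "norm (v n) \<le> W" if "n < N" for n
    unfolding W_def using that by (intro Max_ge) auto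
  have ne: "(\<lambda>n. norm (v n)) ` {..<N} \<noteq> {}" using N by auto
  from Max_in[OF _ ne] obtain k where k: "k < N" "W = norm (v k)"
    unfolding W_def by auto
  \<comment> \<open>The list \<open>v\<close> contains the leading coefficient of every
    \<open>p j\<close>, so it cannot vanish entirely.\<close>
  have "v k \<noteq> 0"
  proof
    assume "v k = 0"
    then have v0: "v n = 0" if "n < N" for n using W[OF that] k by simp
    obtain j where j: "j \<le> d" "p j \<noteq> 0" using p(2) by blast
    have i: "degree (p j) \<le> d" using p(1) j by simp
    have "degree (p j) + (d + 1) * j < (d + 1) * (j + 1)" using i by simp
    also have "\<dots> \<le> N" unfolding N_def power2_eq_square using j by (intro mult_le_mono) auto
    finally have "v (degree (p j) + (d + 1) * j) = 0" by (rule v0)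
    moreover have "v (degree (p j) + (d + 1) * j) = lead_coeff (p j)"
      unfolding v_def div_mod_index[OF i] ..
    ultimately show False using j(2) by simp
  qed
  then have W0: "W > 0" using k by simp
  have K: "norm (taylor_mat d f $$ (i, j)) \<le> real N ^ d" if "i < N" "j < N" for i j
  proof (cases "i < j mod (d + 1)")
    case True
    then show ?thesis using that by (simp add: taylor_mat_def N_def)
  next
    case False
    have jd: "j div (d + 1) \<le> d"
      using less_mult_imp_div_less[of j "d + 1" "d + 1"] that by (simp add: N_def power2_eq_square)
    have "norm (taylor_mat d f $$ (i, j)) \<le> real (i - j mod (d + 1) + 1) ^ (j div (d + 1))"
      using False that norm_coeff_fps_power_le[of a "j div (d + 1)" "i - j mod (d + 1)", OF a]
      by (simp add: taylor_mat_def N_def f_def)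
    also have "\<dots> \<le> real N ^ (j div (d + 1))" using that by (intro power_mono) auto
    also have "\<dots> \<le> real N ^ d" using jd N by (intro power_increasing) auto
    finally show ?thesis .
  qed
  \<comment> \<open>Applied to the largest coefficient \<open>v k\<close>, the adjugate estimate
    yields a row whose Taylor coefficient has modulus \<open>c\<close> not too small relative to
    \<open>W\<close>.\<close>
  obtain m where m: "m < N" and
    big: "norm (Determinant.det (taylor_mat d f)) * norm (v k) \<le>
      fact N * (real N ^ d) ^ (N - 1) * norm (\<Sum>j<N. taylor_mat d f $$ (m, j) * v j)"
    using ex_large_image_coord[OF taylor_mat_carrier[of d f, folded N_def] K k(1)] by blast
  define c where "c = norm (\<Sum>j<N. taylor_mat d f $$ (m, j) * v j)"
  have "\<delta> * W \<le> fact N * (real N ^ d) ^ (N - 1) * c"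
    using det(2) k(2) big unfolding f_def c_def
    by (meson mult_right_mono norm_ge_zero order_trans)
  also have "\<dots> \<le> real N ^ N * (real N ^ d) ^ N * c"
  proof (intro mult_mono power_increasing)
    show "fact N \<le> real N ^ N" using fact_le_power[of N] by (metis of_nat_power)
  qed (use N in \<open>auto simp: c_def\<close>)
  also have "\<dots> = real N ^ ((d + 1) * N) * c"
    by (simp add: power_add flip: power_mult)
  finally have dW: "\<delta> * W \<le> real N ^ ((d + 1) * N) * c" .
  have c: "norm ((deriv ^^ m) F 0) / fact m = c"
    unfolding deriv[OF m] c_def by (simp add: norm_mult)
  have c0: "c > 0"
  proof (rule ccontr)
    assume "\<not> c > 0"
    then have "c = 0" unfolding c_def by (metis norm_ge_zero order_le_less)
    with dW have "\<delta> * W \<le> 0" by simp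
    with mult_pos_pos[OF det(1) W0] show False by linarith
  qed
  \<comment> \<open>On this circle the powers of \<open>z\<close> are at most 1, the series is at
    most 4, and there are \<open>N\<close> terms.\<close>
  have B: "norm (F z) \<le> real N * W * 4 ^ d" if z: "norm z = 3/4" for z
  proof -
    have "norm (F z) \<le> (\<Sum>n<N. W * (1 * 4 ^ d))"
      unfolding F
    proof (rule sum_norm_le)
      fix n assume n: "n \<in> {..<N}"
      have nd: "n div (d + 1) \<le> d"
        using less_mult_imp_div_less[of n "d + 1" "d + 1"] n by (simp add: N_def power2_eq_square)
      have "norm (series_fun a z) ^ (n div (d + 1)) \<le> 4 ^ (n div (d + 1))"
        using norm_series_fun_le[of a z, OF a z] by (intro power_mono) auto
      also have "\<dots> \<le> 4 ^ d" using nd by (intro power_increasing) auto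
      finally show "norm (v n * (z ^ (n mod (d + 1)) * series_fun a z ^ (n div (d + 1)))) \<le> W * (1 * 4 ^ d)"
        unfolding norm_mult norm_power using W n z W0
        by (intro mult_mono power_le_one) auto
    qed
    then show ?thesis by simp
  qed
  have "(deriv ^^ m) F 0 \<noteq> 0" using c c0 by auto
  from zero_count_le[OF hol B this] obtain n where
    n: "zero_count F (cball 0 (1/4)) = enat n" "c \<le> real N * W * 4 ^ d * (3/4) ^ n * 8 ^ m"
    unfolding c by blast
  have "\<delta> * W * (4/3) ^ n \<le> real N ^ ((d + 1) * N) * c * (4/3) ^ n"
    using dW by (intro mult_right_mono) auto
  also have "\<dots> \<le> real N ^ ((d + 1) * N) * (real N * W * 4 ^ d * (3/4) ^ n * 8 ^ m) * (4/3) ^ n"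
    using n(2) by (intro mult_right_mono mult_left_mono) auto
  also have "\<dots> = real N ^ ((d + 1) * N + 1) * 4 ^ d * 8 ^ m * W * ((3/4) ^ n * (4/3) ^ n)"
    by (simp add: mult_ac)
  also have "(3/4) ^ n * (4/3) ^ n = (1::real)"
    by (simp flip: power_mult_distrib)
  \<comment> \<open>The row \<open>m\<close> depends on \<open>p\<close>; \<open>m < N\<close>
    replaces it by a bound in \<open>d\<close> alone.\<close>
  also have "real N ^ ((d + 1) * N + 1) * 4 ^ d * 8 ^ m * W * 1 \<le>
     real N ^ ((d + 1) * N + 1) * 4 ^ d * 8 ^ N * W"
    using m W0 by (auto intro!: mult_right_mono mult_left_mono power_increasing)
  finally have "\<delta> * (4/3) ^ n \<le> real N ^ ((d + 1) * N + 1) * 4 ^ d * 8 ^ N"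
    using W0 by (simp add: field_simps)
  with n(1) show ?thesis unfolding F_def by blast
qed

section \<open>Numerical form of the bound and conclusion\<close>

lemma zero_bound_arith:
  assumes d: "d \<ge> 1" and e: "0 < e" "e < 1"
  defines "N \<equiv> (d + 1)\<^sup>2"
  assumes n: "(e / (det_degree d * 2 ^ d)) ^ det_degree d * (4/3) ^ n \<le>
    real N ^ ((d + 1) * N + 1) * 4 ^ d * 8 ^ N"
  shows "real n \<le> (348 + 16 * ln (1 / e)) * real d ^ 8"
proof -
  define D where "D = det_degree d"
  define L where "L = ln (1 / e)"
  define x where "x = real d"
  have x1: "x \<ge> 1" using d by (simp add: x_def)
  have L0: "L \<ge> 0" unfolding L_def using e by (intro ln_ge_zero) auto
  have D0: "D > 0" unfolding D_def using d by (rule det_degree_pos)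
  have N0: "N > 0" by (simp add: N_def)
  have Nx: "real N \<le> 4 * x\<^sup>2"
  proof -
    have "real N = (x + 1)\<^sup>2" by (simp add: N_def x_def)
    also have "\<dots> \<le> (2 * x)\<^sup>2" using x1 by (intro power_mono) auto
    finally show ?thesis by simp
  qed
  have Dx: "real D \<le> 4 * x ^ 3"
  proof -
    have "real D \<le> real (N * d)" unfolding D_def N_def using det_degree_le[of d] by (rule of_nat_mono)
    also have "\<dots> = real N * x" by (simp add: x_def)
    also have "\<dots> \<le> 4 * x\<^sup>2 * x" using Nx x1 by (intro mult_right_mono) auto
    finally show ?thesis by (simp add: power3_eq_cube power2_eq_square)
  qed
  have lnN: "ln (real N) \<le> 4 * x\<^sup>2" using ln_bound[of "real N"] N0 Nx by simp
  have lnD: "ln (real D) \<le> 4 * x ^ 3" using ln_bound[of "real D"] D0 Dx by simp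
  have ln2: "ln (2::real) \<le> 1" "ln (4::real) \<le> 3" "ln (8::real) \<le> 7"
    using ln_le_minus_one[of 2] ln_le_minus_one[of 4] ln_le_minus_one[of 8] by simp_all
  \<comment> \<open>The inequality \<open>ln y \<le> y - 1\<close> at 3/4, with the sign
    reversed.\<close>
  have ln43: "1/4 \<le> ln (4/3 :: real)"
    using ln_le_minus_one[of "3/4"] ln_div[of 3 4] ln_div[of 4 3] by simp
  have pos: "0 < e / (D * 2 ^ d)" using e D0 by simp
  define k where "k = (d + 1) * N + 1"
  \<comment> \<open>Taking logarithms makes the estimate linear in \<open>n\<close>; every other
    term is then a polynomial in \<open>x\<close>, up to the summand with \<open>L\<close>.\<close>
  have "ln ((e / (D * 2 ^ d)) ^ D * (4/3) ^ n) \<le> ln (real N ^ k * 4 ^ d * 8 ^ N)"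
    using n pos N0 unfolding D_def[symmetric] k_def by (intro ln_mono) auto
  moreover have "ln ((e / (D * 2 ^ d)) ^ D * (4/3) ^ n) = real D * ln (e / (D * 2 ^ d)) + n * ln (4/3)"
    using pos by (subst ln_mult_pos) (auto simp: ln_realpow)
  moreover have "ln (real N ^ k * 4 ^ d * 8 ^ N) = real k * ln N + d * ln 4 + N * ln 8"
    using N0 by (simp add: ln_mult_pos ln_realpow)
  ultimately have "real D * ln (e / (D * 2 ^ d)) + n * ln (4/3) \<le> real k * ln N + d * ln 4 + N * ln 8"
    by simp
  moreover have "ln (e / (D * 2 ^ d)) = - (L + ln D + d * ln 2)"
    using e D0 by (simp add: L_def ln_div ln_mult_pos ln_realpow)
  ultimately have "real D * - (L + ln D + d * ln 2) + n * ln (4/3) \<le>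
      real k * ln N + d * ln 4 + N * ln 8"
    by simp
  then have main: "n * ln (4/3) \<le>
      real k * ln N + d * ln 4 + N * ln 8 + real D * (L + ln D + d * ln 2)"
    unfolding mult_minus_right by linarith
  have pw: "x ^ k \<le> x ^ 8" if "k \<le> 8" for k using x1 that by (intro power_increasing) auto
  have t1: "real k * ln N \<le> 36 * x ^ 8"
  proof -
    have "real k = (x + 1) * real N + 1" by (simp add: k_def x_def algebra_simps)
    also have "\<dots> \<le> (2 * x) * (4 * x\<^sup>2) + x ^ 3"
      using Nx x1 by (intro add_mono mult_mono) auto
    also have "\<dots> = 9 * x ^ 3" by (simp add: power3_eq_cube power2_eq_square)
    finally have "real k * ln N \<le> (9 * x ^ 3) * (4 * x\<^sup>2)"
      using lnN x1 N0 by (intro mult_mono) auto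
    also have "\<dots> = 36 * x ^ 5" by (simp flip: power_add)
    finally show ?thesis using pw[of 5] by simp
  qed
  have t2: "d * ln 4 \<le> 3 * x ^ 8"
  proof -
    have "d * ln 4 \<le> x * 3" unfolding x_def using ln2 by (intro mult_left_mono) auto
    then show ?thesis using pw[of 1] by simp
  qed
  have t3: "N * ln 8 \<le> 28 * x ^ 8"
  proof -
    have "N * ln 8 \<le> (4 * x\<^sup>2) * 7" using ln2 Nx by (intro mult_mono) auto
    then show ?thesis using pw[of 2] by simp
  qed
  have t4: "real D * (L + ln D + d * ln 2) \<le> (20 + 4 * L) * x ^ 8"
  proof -
    have "d * ln 2 \<le> x * 1" unfolding x_def using ln2 by (intro mult_left_mono) auto
    \<comment> \<open>Everything is raised to order \<open>x ^ 3\<close>, the crude bound for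
      \<open>ln D\<close>. The factor \<open>D\<close> then gives order \<open>x ^ 6\<close>, the
      largest of all the terms.\<close>
    then have "L + ln D + d * ln 2 \<le> L * x ^ 3 + 4 * x ^ 3 + x ^ 3"
      using lnD mult_left_mono[OF one_le_power[OF x1, of 3] L0] power_increasing[of 1 3 x] x1
      by simp
    then have "real D * (L + ln D + d * ln 2) \<le> (4 * x ^ 3) * (L * x ^ 3 + 4 * x ^ 3 + x ^ 3)"
      using Dx L0 D0 x1 by (intro mult_mono) auto
    also have "\<dots> = (20 + 4 * L) * x ^ 6"
      by (simp add: algebra_simps flip: power_add)
    also have "\<dots> \<le> (20 + 4 * L) * x ^ 8" using pw[of 6] L0 by (intro mult_left_mono) auto
    finally show ?thesis .
  qed
  have "n * (1/4) \<le> n * ln (4/3)" using ln43 by (intro mult_left_mono) auto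
  also have "\<dots> \<le> 36 * x ^ 8 + 3 * x ^ 8 + 28 * x ^ 8 + (20 + 4 * L) * x ^ 8"
    using main t1 t2 t3 t4 by linarith
  \<comment> \<open>Clearing the factor 1/4 gives the constants: 4 * (36 + 3 + 28 + 20) = 348 and 4
    * 4 = 16.\<close>
  finally show ?thesis unfolding L_def[symmetric] x_def[symmetric] by (simp add: algebra_simps)
qed

lemma bezout_number_good_set:
  assumes a: "a \<in> good_set e" and e: "0 < e" "e < 1" and d: "d \<ge> 1"
  shows "ereal_of_enat (bezout_number d (series_fun a)) \<le> ereal ((348 + 16 * ln (1 / e)) * real d ^ 8)"
proof -
  define C where "C = (348 + 16 * ln (1 / e)) * real d ^ 8"
  have a1: "\<bar>a k\<bar> \<le> 1" for k
    using a coeff_measure_abs_le by (auto simp: good_set_def)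
  have C0: "C \<ge> 0" unfolding C_def using e by (intro mult_nonneg_nonneg add_nonneg_nonneg) auto
  \<comment> \<open>The supremum is taken in \<open>enat\<close>, so the real bound is first rounded
    down.\<close>
  have "bezout_number d (series_fun a) \<le> enat (nat \<lfloor>C\<rfloor>)"
    unfolding bezout_number_def
  proof (rule SUP_least)
    fix p :: "nat \<Rightarrow> complex poly"
    assume p: "p \<in> {p. (\<forall>j\<le>d. degree (p j) \<le> d) \<and> (\<exists>j\<le>d. p j \<noteq> 0)}"
    define \<delta> where "\<delta> = (e / (det_degree d * 2 ^ d)) ^ det_degree d"
    have \<delta>: "\<delta> > 0"
      unfolding \<delta>_def using e det_degree_pos[OF d] by simp
    have det: "\<delta> \<le> norm (Determinant.det (taylor_mat d (coeff_fps a)))"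
      using a d unfolding \<delta>_def good_set_def by (auto intro: less_imp_le)
    have deg: "degree (p j) \<le> d" if "j \<le> d" for j using p that by auto
    have nz: "\<exists>j\<le>d. p j \<noteq> 0" using p by auto
    obtain n where
      n: "zero_count (\<lambda>z. \<Sum>j\<le>d. poly (p j) z * series_fun a z ^ j) (cball 0 (1/4)) = enat n"
        "\<delta> * (4/3) ^ n \<le>
         real ((d + 1)\<^sup>2) ^ ((d + 1) * (d + 1)\<^sup>2 + 1) * 4 ^ d * 8 ^ ((d + 1)\<^sup>2)"
      using zero_count_combination[of a d p \<delta>, OF a1 deg nz \<delta> det] by blast
    have "real n \<le> C" unfolding C_def by (rule zero_bound_arith[OF d e n(2)[unfolded \<delta>_def]])
    then have "n \<le> nat \<lfloor>C\<rfloor>" by (simp add: le_nat_floor)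
    with n(1) show "zero_count (\<lambda>z. \<Sum>j\<le>d. poly (p j) z * series_fun a z ^ j) (cball 0 (1/4)) \<le>
        enat (nat \<lfloor>C\<rfloor>)" by simp
  qed
  then have "ereal_of_enat (bezout_number d (series_fun a)) \<le> ereal_of_enat (enat (nat \<lfloor>C\<rfloor>))"
    by (simp only: ereal_of_enat_le_iff)
  also have "\<dots> \<le> ereal C" using C0 by simp
  finally show ?thesis unfolding C_def .
qed

theorem corollary4p0p3:
  "(\<exists>(E :: real \<Rightarrow> (nat \<Rightarrow> real) set) (C :: real \<Rightarrow> real).
      (\<forall>p. 0 < p \<and> p < 1 \<longrightarrow>
         E p \<in> sets coeff_measure \<and> measure coeff_measure (E p) = p \<and>
         (\<forall>a \<in> E p. \<forall>d::nat. d \<ge> 1 \<longrightarrow>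
            ereal_of_enat (bezout_number d (series_fun a)) \<le> ereal (C p * real d ^ 8))) \<and>
      filterlim C at_top (at_left 1)) \<and>
   (AE a in coeff_measure. \<exists>C::real. \<forall>d::nat. d \<ge> 1 \<longrightarrow>
      ereal_of_enat (bezout_number d (series_fun a)) \<le> ereal (C * real d ^ 8))"
proof
  \<comment> \<open>The bound for \<open>good_set e\<close> at \<open>e = 1 - p\<close>; its
    logarithm diverges as \<open>p\<close> tends to 1.\<close>
  define C :: "real \<Rightarrow> real" where "C p = 348 + 16 * ln (1 / (1 - p))" for p
  have "\<exists>E. 0 < p \<and> p < 1 \<longrightarrow> E \<in> sets coeff_measure \<and> measure coeff_measure E = p \<and>
      (\<forall>a \<in> E. \<forall>d\<ge>1. ereal_of_enat (bezout_number d (series_fun a)) \<le> ereal (C p * real d ^ 8))" for p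
  proof (cases "0 < p \<and> p < 1")
    case True
    then have "measure coeff_measure (good_set (1 - p)) \<ge> p"
      using measure_good_set(2)[of "1 - p"] by simp
    then obtain E where "E \<in> sets coeff_measure" "E \<subseteq> good_set (1 - p)" "measure coeff_measure E = p"
      using ex_subset_of_measure[OF measure_good_set(1)[of "1 - p"], of p] True by auto
    then show ?thesis
      using bezout_number_good_set[of _ "1 - p"] True unfolding C_def by (intro exI[of _ E]) auto
  qed auto
  then obtain E where "\<forall>p. 0 < p \<and> p < 1 \<longrightarrow> E p \<in> sets coeff_measure \<and>
      measure coeff_measure (E p) = p \<and> (\<forall>a \<in> E p. \<forall>d\<ge>1.
        ereal_of_enat (bezout_number d (series_fun a)) \<le> ereal (C p * real d ^ 8))"
    by metis
  moreover have "filterlim C at_top (at_left 1)"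
    unfolding C_def by real_asymp
  ultimately show "\<exists>(E :: real \<Rightarrow> (nat \<Rightarrow> real) set) (C :: real \<Rightarrow> real).
      (\<forall>p. 0 < p \<and> p < 1 \<longrightarrow>
         E p \<in> sets coeff_measure \<and> measure coeff_measure (E p) = p \<and>
         (\<forall>a \<in> E p. \<forall>d::nat. d \<ge> 1 \<longrightarrow>
            ereal_of_enat (bezout_number d (series_fun a)) \<le> ereal (C p * real d ^ 8))) \<and>
      filterlim C at_top (at_left 1)"
    by blast
next
  interpret M: prob_space coeff_measure by (rule prob_space_coeff_measure)
  \<comment> \<open>Good sets with parameters tending to 0 have a union of full measure; a point of
    the union inherits the constant of any good set containing it.\<close>
  define e :: "nat \<Rightarrow> real" where "e n = (1/2) ^ Suc n" for n
  have e: "0 < e n" "e n < 1" for n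
    unfolding e_def by (simp, intro power_Suc_less_one) auto
  have meas: "(\<Union>n. good_set (e n)) \<in> sets coeff_measure"
    using measure_good_set(1) e by auto
  have "1 - e n \<le> M.prob (\<Union>n. good_set (e n))" for n
    using measure_good_set(2)[OF e(1)[of n]] M.finite_measure_mono[OF _ meas, of "good_set (e n)"]
    by fastforce
  moreover have "(\<lambda>n. 1 - e n) \<longlonglongrightarrow> 1" unfolding e_def by real_asymp
  ultimately have "1 \<le> M.prob (\<Union>n. good_set (e n))"
    by (intro LIMSEQ_le_const2) auto
  then have "M.prob (\<Union>n. good_set (e n)) = 1"
    using M.prob_le_1 order_antisym by blast
  then have "AE a in coeff_measure. a \<in> (\<Union>n. good_set (e n))"
    by (simp add: M.prob_eq_1[OF meas])
  then show "AE a in coeff_measure. \<exists>C::real. \<forall>d::nat. d \<ge> 1 \<longrightarrow>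
      ereal_of_enat (bezout_number d (series_fun a)) \<le> ereal (C * real d ^ 8)"
  proof eventually_elim
    case (elim a)
    then obtain n where "a \<in> good_set (e n)" by blast
    from bezout_number_good_set[OF this e] show ?case by blast
  qed
qed

end
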